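(* For integers $p\geq1$, $q\geq2$ and $\sigma_1,\sigma_2\in\{\pm1\}$, the linear Euler $T$-sums $T_{p,q}^{\sigma_1,\sigma_2}=\sum_{n=1}^\infty\sigma_2^{n-1}\frac{h_{n-1}^{(p)}(\sigma_1)}{(n-1/2)^q}$ satisfy \begin{align*} (-1)^p\delta_{\sigma_1\sigma_2}^{p+q}\,T_{p,q}^{\sigma_1,\sigma_2} &=(-1)^q\tilde t(p+q;\sigma_1\sigma_2)-\sigma_2\delta_{\sigma_2}^{q-1}\,\tilde t(p;\sigma_1)\tilde t(q;\sigma_2)\\ &\quad+\sum_{k=1}^p\delta_{\sigma_1\sigma_2}^{p-k}\binom{q+k-2}{q-1} \tilde t(p-k+1;\sigma_1\sigma_2)\,\zeta(q+k-1;\sigma_2)\\ &\quad+\sigma_1\sigma_2\sum_{k=1}^q\delta_{\sigma_1\sigma_2}^{q-k}\binom{p+k-2}{p-1} \tilde t(q-k+1;\sigma_1\sigma_2)\,\zeta(p+k-1;\sigma_1), \end{align*} where $\zeta(1;1):=0$ and $\tilde t(1;1):=2\ln 2$ wherever they occur.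
   Context: For $\sigma\in\{\pm1\}$ and integers $n\ge0$, $r\ge1$: $h_n^{(r)}(\sigma)=\sum_{k=1}^n\frac{\sigma^{k-1}}{(k-1/2)^r}$ (so $h_0^{(r)}(\sigma)=0$). For $(s,\sigma)\ne(1,1)$: $\zeta(s;\sigma)=\sum_{n\ge1}\frac{\sigma^n}{n^s}$ and $\tilde t(s;\sigma)=\sum_{n\ge1}\frac{\sigma^n}{(n-1/2)^s}$. Also $\delta_\sigma^k=1-\sigma(-1)^k$ for $\sigma=\pm1$ and integer $k$. *)

theory Defs
  imports "HOL-Analysis.Analysis"
begin

(* A sign sigma is a real number, constrained to {1, -1} where the notions below are used.
   Series over n >= 1 are suminf-series in the shifted index Suc n; the ordered sum
   also covers the conditionally convergent case s = 1, sigma = -1. *)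

definition h_sum :: "nat \<Rightarrow> nat \<Rightarrow> real \<Rightarrow> real" where
  "h_sum n r \<sigma> = (\<Sum>k=1..n. \<sigma> ^ (k - 1) / (real k - 1/2) ^ r)"

(* The series diverges at (1, 1); the regularised values used there are 0 and 2 ln 2. *)

definition alt_zeta :: "nat \<Rightarrow> real \<Rightarrow> real" where
  "alt_zeta s \<sigma> =
     (if s = 1 \<and> \<sigma> = 1 then 0 else (\<Sum>n. \<sigma> ^ Suc n / real (Suc n) ^ s))"

definition alt_t :: "nat \<Rightarrow> real \<Rightarrow> real" where
  "alt_t s \<sigma> =
     (if s = 1 \<and> \<sigma> = 1 then 2 * ln 2
      else (\<Sum>n. \<sigma> ^ Suc n / (real (Suc n) - 1/2) ^ s))"

definition delta :: "real \<Rightarrow> int \<Rightarrow> real" where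
  "delta \<sigma> k = 1 - \<sigma> * (-1) powi k"

definition euler_T :: "nat \<Rightarrow> nat \<Rightarrow> real \<Rightarrow> real \<Rightarrow> real" where
  "euler_T p q \<sigma>1 \<sigma>2 =
     (\<Sum>n. \<sigma>2 ^ (Suc n - 1) * h_sum (Suc n - 1) p \<sigma>1 / (real (Suc n) - 1/2) ^ q)"

end

theory Submission
  imports Defs
begin

text \<open>
  Let x run over all half-integers and put y = x + d with an integer d \<ge> 1. Decompose
  1 / (x^p y^q) into partial fractions with respect to y - x = d, weight by
  \<sigma>1^(x - 1/2) \<sigma>2^(y - 1/2) and sum symmetrically over x, then over d \<le> D. The partial
  fractions separate the variables: they give bilateral sums, which are multiples of
  alt_t (j, \<sigma>1 \<sigma>2), times partial sums of alt_zeta. On the other side the pairs x < y split by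
  sign into 0 < x < y, which tends to T(p,q), x < 0 < y, which tends to a product of two
  t-values, and x < y < 0, which by reflection and summing over x first tends to that product
  minus T(p,q) and the diagonal. For p = 1 and \<sigma>1 = 1 both sides diverge like the same
  multiple of the harmonic number of D, and cancelling it leaves the regularised values
  2 ln 2 and 0.
\<close>

subsection \<open>Regularised one-sided sums\<close>

text \<open>At exponent 1 only the sign -1 is left, and Leibniz's test applies. The offset
  \<open>c\<close> is free because \<open>alt_zeta\<close> needs 1 and \<open>alt_t\<close> needs
  1/2.\<close>

lemma summable_signed:
  fixes c \<sigma> :: real
  assumes "\<sigma> \<in> {1, -1}" "s \<ge> 1" "\<not> (s = 1 \<and> \<sigma> = 1)" "c > 0"
  shows "summable (\<lambda>n. \<sigma> ^ n / (real n + c) ^ s)"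
proof (cases "s = 1")
  case False
  then have s: "s \<ge> 2" using assms by simp
  have "summable (\<lambda>n. inverse (real n ^ s))"
    using s by (rule inverse_power_summable)
  then show ?thesis
  proof (rule summable_comparison_test'[where N = 1])
    fix n :: nat assume "n \<ge> 1"
    then have "real n ^ s \<le> (real n + c) ^ s" "real n ^ s > 0"
      using assms by (auto intro!: power_mono)
    then show "norm (\<sigma> ^ n / (real n + c) ^ s) \<le> inverse (real n ^ s)"
      using assms by (auto simp: norm_divide norm_power field_simps)
  qed
next
  case True
  then have [simp]: "s = 1" "\<sigma> = -1" using assms by auto
  have "(\<lambda>n. 1 / (real n + c)) \<longlonglongrightarrow> 0"
    by real_asymp
  then have "summable (\<lambda>n. (-1) ^ n * (1 / (real n + c)))"
    using assms by (intro summable_Leibniz(1)) (auto simp: monoseq_Suc frac_le)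
  then show ?thesis by simp
qed

text \<open>Subtracting \<open>harm D\<close> at the divergent pair (1, 1) makes the difference
  identically 0, the default value of \<open>alt_zeta\<close>, so one limit statement covers all
  cases.\<close>

lemma LIMSEQ_signed_harmonic:
  assumes "\<sigma> \<in> {1, -1}" "s \<ge> 1"
  shows "(\<lambda>D. (\<Sum>d=1..D. \<sigma> ^ d / real d ^ s) - (if s = 1 \<and> \<sigma> = 1 then harm D else 0))
           \<longlonglongrightarrow> alt_zeta s \<sigma>"
proof (cases "s = 1 \<and> \<sigma> = 1")
  case True
  then show ?thesis by (simp add: alt_zeta_def harm_def inverse_eq_divide)
next
  case False
  then have "summable (\<lambda>n. \<sigma> * (\<sigma> ^ n / (real n + 1) ^ s))"
    using assms by (intro summable_mult summable_signed) auto
  then have "(\<lambda>n. \<sigma> ^ Suc n / real (Suc n) ^ s) sums alt_zeta s \<sigma>"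
    using False by (auto simp: alt_zeta_def algebra_simps intro!: summable_sums)
  moreover have "(\<Sum>d<D. \<sigma> ^ Suc d / real (Suc d) ^ s) = (\<Sum>d=1..D. \<sigma> ^ d / real d ^ s)" for D
    by (rule sum.reindex_bij_witness[of _ "\<lambda>d. d - 1" Suc]) auto
  ultimately show ?thesis using False by (simp add: sums_def if_not_P del: sum.lessThan_Suc
      of_nat_Suc power_Suc One_nat_def)
qed

text \<open>Index \<open>n\<close> stands for the half-integer n + 1/2. The weight is
  \<open>\<sigma> ^ n\<close>, while \<open>alt_t\<close> carries one more power of
  \<open>\<sigma>\<close>.\<close>

definition t_term :: "nat \<Rightarrow> real \<Rightarrow> nat \<Rightarrow> real" where
  "t_term r \<sigma> n = \<sigma> ^ n / (real n + 1/2) ^ r"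

lemma h_sum_eq_sum_t_term: "h_sum n r \<sigma> = (\<Sum>u<n. t_term r \<sigma> u)"
  unfolding h_sum_def t_term_def
  by (rule sum.reindex_bij_witness[of _ Suc "\<lambda>d. d - 1"])
     (auto simp: of_nat_diff algebra_simps)

text \<open>1/(k - 1/2) is twice the reciprocal of the odd number 2k - 1, and the odd reciprocals
  below 2n sum to \<open>harm (2 * n)\<close> minus half of \<open>harm n\<close>.\<close>

lemma h_sum_one_one: "h_sum n 1 1 = 2 * harm (2 * n) - harm n"
proof (induction n)
  case 0
  then show ?case by (simp add: h_sum_eq_sum_t_term harm_expand)
next
  case (Suc n)
  have "h_sum (Suc n) 1 1 = h_sum n 1 1 + 1 / (real n + 1/2)"
    by (simp add: h_sum_eq_sum_t_term t_term_def)
  moreover have "harm (2 * Suc n) = harm (2 * n) + 1 / (2 * real n + 1) + 1 / (2 * real n + 2)"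
    by (simp add: harm_Suc inverse_eq_divide add.commute)
  moreover have "harm (Suc n) = harm n + 1 / (real n + 1)"
    by (simp add: harm_Suc inverse_eq_divide)
  moreover have "1 / (real n + 1/2) = 2 * (1 / (2 * real n + 1))"
    "2 * (1 / (2 * real n + 2)) = 1 / (real n + 1)"
    by (simp_all add: divide_simps)
  ultimately show ?case using Suc by (simp add: algebra_simps)
qed

text \<open>\<open>harm n - ln n\<close> has the same limit along n and along 2n, so only ln(2n) -
  ln n = ln 2 survives.\<close>

lemma LIMSEQ_harm_double: "(\<lambda>n. harm (2 * n) - harm n :: real) \<longlonglongrightarrow> ln 2"
proof -
  have e: "(\<lambda>n. harm n - ln (real n)) \<longlonglongrightarrow> euler_mascheroni"
    by (rule euler_mascheroni_LIMSEQ)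
  have "filterlim (\<lambda>n::nat. 2 * n) sequentially sequentially"
    by (rule filterlim_subseq) (auto simp: strict_mono_def)
  from filterlim_compose[OF e this]
  have "(\<lambda>n. (harm (2 * n) - ln (real (2 * n))) - (harm n - ln (real n)) + ln 2)
          \<longlonglongrightarrow> euler_mascheroni - euler_mascheroni + ln 2"
    by (intro tendsto_intros e)
  moreover have "eventually (\<lambda>n. (harm (2 * n) - ln (real (2 * n))) - (harm n - ln (real n)) + ln 2
      = harm (2 * n) - harm n) sequentially"
    using eventually_gt_at_top[of 0] by eventually_elim (simp add: ln_mult)
  ultimately show ?thesis
    by (auto elim!: Lim_transform_eventually)
qed

text \<open>The compensator is the same as in \<open>LIMSEQ_signed_harmonic\<close>. At (1, 1) it
  leaves \<open>2 * (harm (2 * D) - harm D)\<close>, whence the regularised value 2 ln 2.\<close>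

lemma LIMSEQ_h_sum:
  assumes "\<sigma> \<in> {1, -1}" "s \<ge> 1"
  shows "(\<lambda>D. \<sigma> * h_sum D s \<sigma> - (if s = 1 \<and> \<sigma> = 1 then harm D else 0)) \<longlonglongrightarrow> alt_t s \<sigma>"
proof (cases "s = 1 \<and> \<sigma> = 1")
  case True
  have "(\<lambda>n. 2 * (harm (2 * n) - harm n) :: real) \<longlonglongrightarrow> 2 * ln 2"
    by (intro tendsto_intros LIMSEQ_harm_double)
  with True show ?thesis
    by (simp add: alt_t_def h_sum_one_one algebra_simps del: One_nat_def)
next
  case False
  then have "summable (\<lambda>n. \<sigma> * t_term s \<sigma> n)"
    using assms unfolding t_term_def by (intro summable_mult summable_signed) auto
  then have "(\<lambda>n. \<sigma> * t_term s \<sigma> n) sums alt_t s \<sigma>"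
    using False by (auto simp: alt_t_def t_term_def algebra_simps intro!: summable_sums)
  then show ?thesis using False by (simp add: sums_def h_sum_eq_sum_t_term sum_distrib_left if_not_P
      del: One_nat_def)
qed

lemma t_term_sums:
  assumes "\<sigma> \<in> {1, -1}" "q \<ge> 2"
  shows "t_term q \<sigma> sums (\<sigma> * alt_t q \<sigma>)"
proof -
  have "(\<lambda>D. \<sigma> * (\<sigma> * h_sum D q \<sigma>)) \<longlonglongrightarrow> \<sigma> * alt_t q \<sigma>"
    using LIMSEQ_h_sum[of \<sigma> q] assms by (intro tendsto_intros) auto
  moreover have "(\<lambda>D. \<sigma> * (\<sigma> * h_sum D q \<sigma>)) = (\<lambda>D. h_sum D q \<sigma>)"
    using assms by auto
  ultimately show ?thesis by (simp only: sums_def h_sum_eq_sum_t_term)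
qed

subsection \<open>Symmetric sums over the half-integers\<close>

lemma powi_neg_Suc:
  fixes \<sigma> :: real
  assumes "\<sigma> \<in> {1, -1}"
  shows "\<sigma> powi (- int n - 1) = \<sigma> * \<sigma> ^ n"
proof -
  have "\<sigma> powi (- int n - 1) = inverse (\<sigma> powi (int (Suc n)))"
    by (subst power_int_minus[symmetric], rule arg_cong) simp
  also have "\<dots> = \<sigma> * \<sigma> ^ n"
    using assms by (cases "even n") (auto simp: power_int_of_nat simp del: of_nat_Suc)
  finally show ?thesis .
qed

text \<open>The half-open window is symmetric about 0 for the half-integers i + 1/2: reflection
  sends the index i to -i - 1.\<close>

lemma sum_symmetric_int:
  fixes f :: "int \<Rightarrow> 'a::comm_monoid_add"
  shows "(\<Sum>i\<in>{- int N..<int N}. f i) = (\<Sum>n<N. f (int n)) + (\<Sum>n<N. f (- int n - 1))"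
proof -
  have "{- int N..<int N} = {0..<int N} \<union> {- int N..<0}" by auto
  then have "(\<Sum>i\<in>{- int N..<int N}. f i) = (\<Sum>i\<in>{0..<int N}. f i) + (\<Sum>i\<in>{- int N..<0}. f i)"
    by (simp add: sum.union_disjoint)
  moreover have "(\<Sum>i\<in>{0..<int N}. f i) = (\<Sum>n<N. f (int n))"
    by (rule sum.reindex_bij_witness[of _ int nat]) auto
  moreover have "(\<Sum>i\<in>{- int N..<0}. f i) = (\<Sum>n<N. f (- int n - 1))"
    by (rule sum.reindex_bij_witness[of _ "\<lambda>n. - int n - 1" "\<lambda>i. nat (- i - 1)"]) auto
  ultimately show ?thesis by simp
qed

definition int_t_term :: "nat \<Rightarrow> real \<Rightarrow> int \<Rightarrow> real" where
  "int_t_term r \<sigma> i = \<sigma> powi i / (of_int i + 1/2) ^ r"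

lemma int_t_term_of_nat [simp]: "int_t_term r \<sigma> (int n) = t_term r \<sigma> n"
  by (simp add: int_t_term_def t_term_def power_int_of_nat)

lemma int_t_term_neg:
  assumes "\<sigma> \<in> {1, -1}"
  shows "int_t_term r \<sigma> (- int n - 1) = \<sigma> * (-1) ^ r * t_term r \<sigma> n"
proof -
  have "(of_int (- int n - 1) + 1/2 :: real) ^ r = (-1) ^ r * (real n + 1/2) ^ r"
    by (subst power_mult_distrib[symmetric]) (simp add: algebra_simps)
  then show ?thesis
    unfolding int_t_term_def t_term_def powi_neg_Suc[OF assms]
    by (cases "even r") auto
qed

text \<open>The limit of the symmetric sums of \<open>int_t_term j \<tau>\<close>. The delta factor
  is 1 + \<tau> (-1)^j, which vanishes exactly when reflected terms cancel.\<close>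

definition bilateral_t :: "nat \<Rightarrow> real \<Rightarrow> real" where
  "bilateral_t j \<tau> = \<tau> * delta \<tau> (int j - 1) * alt_t j \<tau>"

lemma bilateral_t_eq:
  "\<tau> \<in> {1, -1} \<Longrightarrow> bilateral_t j \<tau> = \<tau> * (1 + \<tau> * (-1) ^ j) * alt_t j \<tau>"
  by (auto simp: bilateral_t_def delta_def power_int_diff)

lemma LIMSEQ_bilateral_t:
  assumes "\<tau> \<in> {1, -1}" "j \<ge> 1"
  shows "(\<lambda>N. \<Sum>i\<in>{- int N..<int N}. int_t_term j \<tau> i) \<longlonglongrightarrow> bilateral_t j \<tau>"
proof -
  have eq: "(\<Sum>i\<in>{- int N..<int N}. int_t_term j \<tau> i)
      = (1 + \<tau> * (-1) ^ j) * h_sum N j \<tau>" for N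
    using assms(1)
    unfolding sum_symmetric_int h_sum_eq_sum_t_term
    by (simp add: int_t_term_neg[OF assms(1)] sum_distrib_left sum.distrib distrib_right)
  show ?thesis
  proof (cases "j = 1 \<and> \<tau> = 1")
    \<comment> \<open>\<open>h_sum\<close> diverges here, but the factor in front of it is 0, so all
      symmetric sums vanish.\<close>
    case True
    then show ?thesis unfolding eq by (simp add: bilateral_t_eq)
  next
    case False
    have "(\<lambda>N. (1 + \<tau> * (-1) ^ j) * (\<tau> * (\<tau> * h_sum N j \<tau> - 0)))
       \<longlonglongrightarrow> (1 + \<tau> * (-1) ^ j) * (\<tau> * alt_t j \<tau>)"
      using LIMSEQ_h_sum[OF assms] False by (intro tendsto_intros) auto
    then show ?thesis using assms unfolding eq bilateral_t_eq[OF assms(1)]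
      by (auto simp: algebra_simps)
  qed
qed

text \<open>Convergence is assumed along symmetric windows only, so shifts need an argument: moving
  the window by one trades one term at each end, and these terms tend to 0.\<close>

lemma LIMSEQ_symmetric_sum_shift:
  fixes f :: "int \<Rightarrow> 'a::real_normed_vector"
  assumes "(\<lambda>N. \<Sum>i\<in>{- int N..<int N}. f i) \<longlonglongrightarrow> L"
    and pos: "(\<lambda>n. f (int n)) \<longlonglongrightarrow> 0" and neg: "(\<lambda>n. f (- int n)) \<longlonglongrightarrow> 0"
  shows "(\<lambda>N. \<Sum>i\<in>{- int N..<int N}. f (i + int d)) \<longlonglongrightarrow> L"
proof (induction d)
  case 0
  then show ?case using assms by simp
next
  case (Suc d)
  have eq: "(\<Sum>i\<in>{- int N..<int N}. f (i + int (Suc d)))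
      = (\<Sum>i\<in>{- int N..<int N}. f (i + int d)) + f (int (N + d)) - f (- int N + int d)" for N
  proof -
    have "(\<Sum>i\<in>{- int N..<int N}. f (i + int (Suc d))) = (\<Sum>i\<in>{- int N + 1..<int N + 1}. f (i + int d))"
      by (rule sum.reindex_bij_witness[of _ "\<lambda>i. i - 1" "\<lambda>i. i + 1"]) (auto simp: algebra_simps)
    \<comment> \<open>Both windows are enlarged by one boundary point to the closed interval from -N
      to N.\<close>
    also have "\<dots> + f (- int N + int d) = (\<Sum>i\<in>insert (- int N) {- int N + 1..<int N + 1}. f (i + int d))"
      by (simp add: add.commute)
    also have "insert (- int N) {- int N + 1..<int N + 1} = insert (int N) {- int N..<int N}"
      by auto
    also have "(\<Sum>i\<in>\<dots>. f (i + int d)) = f (int (N + d)) + (\<Sum>i\<in>{- int N..<int N}. f (i + int d))"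
      by simp
    finally show ?thesis by (simp add: algebra_simps)
  qed
  have "(\<lambda>N. f (int (N + d))) \<longlonglongrightarrow> 0"
    using LIMSEQ_ignore_initial_segment[OF pos, of d] .
  moreover have "(\<lambda>N. f (- int N + int d)) \<longlonglongrightarrow> 0"
    by (rule LIMSEQ_offset[of _ d]) (use neg in simp)
  ultimately have "(\<lambda>N. (\<Sum>i\<in>{- int N..<int N}. f (i + int d)) + f (int (N + d))
      - f (- int N + int d)) \<longlonglongrightarrow> L + 0 - 0"
    by (intro tendsto_intros Suc)
  then show ?case unfolding eq by simp
qed

subsection \<open>Partial fractions\<close>

text \<open>The principal part at x = 0 of 1/(x^m (x + d)^n): the binomial series of (x + d)^(-n) up
  to k = m - 1, divided by x^m.\<close>

definition pfrac :: "nat \<Rightarrow> nat \<Rightarrow> 'a::field \<Rightarrow> 'a \<Rightarrow> 'a" where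
  "pfrac m n x d = (\<Sum>k<m. (-1) ^ k * of_nat ((n + k - 1) choose k) / (d ^ (n + k) * x ^ (m - k)))"

text \<open>Mirrors 1/(x y) = (1/x - 1/y)/d for y = x + d; on coefficients it is Pascal's
  rule.\<close>

lemma pfrac_Suc_Suc:
  assumes "d \<noteq> 0"
  shows "pfrac (Suc m) (Suc n) x d = (pfrac (Suc m) n x d - pfrac m (Suc n) x d) / d"
proof -
  define T where "T m n k = (-1) ^ k * of_nat ((n + k - 1) choose k) / (d ^ (n + k) * x ^ (m - k))"
    for m n k
  have T0: "T (Suc m) (Suc n) 0 = T (Suc m) n 0 / d"
    by (simp add: T_def)
  have T_Suc: "T (Suc m) (Suc n) (Suc k) = T (Suc m) n (Suc k) / d - T m (Suc n) k / d" for k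
  proof -
    have "T (Suc m) n (Suc k) / d = - ((-1) ^ k
        * of_nat ((n + k) choose Suc k) / (d ^ (Suc n + Suc k) * x ^ (m - k)))"
      by (simp add: T_def)
    moreover have "T m (Suc n) k / d = (-1) ^ k
        * of_nat ((n + k) choose k) / (d ^ (Suc n + Suc k) * x ^ (m - k))"
      by (simp add: T_def)
    moreover have "T (Suc m) (Suc n) (Suc k)
        = - ((-1) ^ k * of_nat (Suc (n + k) choose Suc k) / (d ^ (Suc n + Suc k) * x ^ (m - k)))"
      by (simp add: T_def)
    ultimately show ?thesis
      by (simp only: binomial_Suc_Suc of_nat_add distrib_left add_divide_distrib) simp
  qed
  have pfrac: "pfrac m n x d = (\<Sum>k<m. T m n k)" for m n
    by (simp add: pfrac_def T_def)
  show ?thesis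
    unfolding pfrac sum.lessThan_Suc_shift T0 T_Suc sum_subtractf
    by (simp add: sum_divide_distrib add_divide_distrib diff_divide_distrib)
qed

text \<open>Both sides obey the recursion obtained by multiplying 1/(x y) = (1/x - 1/y)/(y - x) by
  1/(x^m y^n). In the second \<open>pfrac\<close> the roles are swapped and d becomes -d, so the two
  changes of sign compensate.\<close>

lemma partial_fractions:
  fixes x y :: "'a::field"
  assumes "x \<noteq> 0" "y \<noteq> 0" "x \<noteq> y" "p + q \<ge> 1"
  shows "1 / (x ^ p * y ^ q) = pfrac p q x (y - x) + pfrac q p y (x - y)"
  using assms(4)
proof (induction "p + q" arbitrary: p q rule: less_induct)
  case less
  \<comment> \<open>For \<open>q = 0\<close> truncated subtraction makes \<open>(k - 1) choose k\<close> equal to 1 at \<open>k = 0\<close>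
      and 0 elsewhere, so the degenerate exponents serve as induction base.\<close>
  have zero: "pfrac p 0 z d = 1 / z ^ p" if "p \<ge> 1" for p and z d :: 'a
  proof -
    have "pfrac p 0 z d = (\<Sum>k\<in>{0}. (-1) ^ k * of_nat ((k - 1) choose k) / (d ^ k * z ^ (p - k)))"
      unfolding pfrac_def using that
      by (intro sum.mono_neutral_cong_right) (auto simp: binomial_eq_0)
    then show ?thesis by simp
  qed
  have nil: "pfrac 0 q z d = 0" for q and z d :: 'a by (simp add: pfrac_def)
  show ?case
  proof (cases "p = 0 \<or> q = 0")
    case True
    then show ?thesis using less.prems zero nil by auto
  next
    case False
    then obtain m n where [simp]: "p = Suc m" "q = Suc n"
      by (auto simp: gr0_conv_Suc)
    define d where "d = y - x"
    have d: "d \<noteq> 0" "x - y = - d" using assms by (auto simp: d_def)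
    have "1 / (x * y) = (1 / x - 1 / y) / d"
      using assms d(1) by (simp add: d_def diff_frac_eq)
    then have "1 / (x * y) * (1 / (x ^ m * y ^ n)) = (1 / x - 1 / y) / d * (1 / (x ^ m * y ^ n))"
      by simp
    then have "1 / (x ^ p * y ^ q) = (1 / (x ^ Suc m * y ^ n) - 1 / (x ^ m * y ^ Suc n)) / d"
      by (simp add: diff_divide_distrib left_diff_distrib mult_ac)
    also have "1 / (x ^ Suc m * y ^ n) = pfrac (Suc m) n x d + pfrac n (Suc m) y (- d)"
      using less.hyps[of "Suc m" n] by (simp add: d(2) flip: d_def)
    also have "1 / (x ^ m * y ^ Suc n) = pfrac m (Suc n) x d + pfrac (Suc n) m y (- d)"
      using less.hyps[of m "Suc n"] by (simp add: d(2) flip: d_def)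
    finally show ?thesis
      using d(1) by (simp add: pfrac_Suc_Suc d(2) d_def[symmetric] diff_divide_distrib
          add_divide_distrib)
  qed
qed

text \<open>Provides the decay at both ends that \<open>LIMSEQ_symmetric_sum_shift\<close> asks
  for.\<close>

lemma tendsto_int_t_term:
  assumes "\<sigma> \<in> {1, -1}" "r \<ge> 1"
  shows "(\<lambda>n. int_t_term r \<sigma> (int n)) \<longlonglongrightarrow> 0" "(\<lambda>n. int_t_term r \<sigma> (- int n)) \<longlonglongrightarrow> 0"
proof -
  have "(\<lambda>n. 1 / (real n + 1/2)) \<longlonglongrightarrow> 0"
    by real_asymp
  then have "(\<lambda>n. (1 / (real n + 1/2)) ^ r) \<longlonglongrightarrow> 0 ^ r"
    by (intro tendsto_intros)
  then have lim: "(\<lambda>n. 1 / (real n + 1/2) ^ r) \<longlonglongrightarrow> 0"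
    using assms by (simp add: power_one_over zero_power)
  show pos: "(\<lambda>n. int_t_term r \<sigma> (int n)) \<longlonglongrightarrow> 0"
    using assms by (intro Lim_null_comparison[OF _ lim] always_eventually)
      (auto simp: t_term_def abs_mult power_abs)
  have "(\<lambda>n. int_t_term r \<sigma> (- int (n + 1))) \<longlonglongrightarrow> 0"
  proof -
    have "int_t_term r \<sigma> (- int (n + 1)) = \<sigma> * (-1) ^ r * int_t_term r \<sigma> (int n)" for n
    proof -
      have "- int (n + 1) = - int n - 1" by simp
      then show ?thesis
        by (simp only: int_t_term_neg[OF assms(1)] int_t_term_of_nat)
    qed
    then show ?thesis
      using tendsto_mult_right_zero[OF pos, of "\<sigma> * (-1) ^ r"] by simp
  qed
  then show "(\<lambda>n. int_t_term r \<sigma> (- int n)) \<longlonglongrightarrow> 0"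
    by (rule LIMSEQ_offset)
qed

subsection \<open>Bounds and dominated convergence\<close>

text \<open>Rests on 2(n + 1/2) \<ge> u + 1. The free \<open>s\<close> lets one bound serve as a
  constant (s = 0), a harmonic (s = 1) and an inverse-square bound (s = 2).\<close>

lemma abs_t_term_le:
  assumes "\<sigma> \<in> {1, -1}" "s \<le> r" "u \<le> n"
  shows "\<bar>t_term r \<sigma> n\<bar> \<le> 2 ^ r / (real u + 1) ^ s"
proof -
  have "(real u + 1) ^ s \<le> (real u + 1) ^ r"
    using assms by (intro power_increasing) auto
  also have "\<dots> \<le> (2 * (real n + 1/2)) ^ r"
    using assms by (intro power_mono) auto
  finally have "(real u + 1) ^ s \<le> 2 ^ r * (real n + 1/2) ^ r"
    by (simp only: power_mult_distrib)
  moreover have "(real u + 1) ^ s > 0" "(real n + 1/2) ^ r > 0" by auto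
  ultimately have "1 / (real n + 1/2) ^ r \<le> 2 ^ r / (real u + 1) ^ s"
    by (simp add: field_simps)
  then show ?thesis
    using assms by (auto simp: t_term_def abs_mult power_abs)
qed

text \<open>Wherever it starts, a block of v terms is at most 2^r times a harmonic sum of length v.
  The square root bounds that sum crudely, yet stays summable against an inverse square.\<close>

lemma abs_h_sum_diff_le:
  assumes "\<sigma> \<in> {1, -1}" "r \<ge> 1"
  shows "\<bar>h_sum (n + v) r \<sigma> - h_sum n r \<sigma>\<bar> \<le> 2 ^ r * (2 * sqrt (real v))"
proof (induction v)
  case 0
  then show ?case by simp
next
  case (Suc v)
  \<comment> \<open>The increment of the bound dominates the new term: 2(z - w) \<ge> 1/z \<ge>
    1/z^2, since z \<ge> 1.\<close>
  define w where "w = sqrt (real v)"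
  define z where "z = sqrt (real v + 1)"
  have wz: "0 \<le> w" "w \<le> z" "0 < z" "z\<^sup>2 - w\<^sup>2 = 1" "z\<^sup>2 = real v + 1"
    by (auto simp: w_def z_def)
  have "(z - w) * (z + w) = 1"
    using wz by (simp add: power2_eq_square algebra_simps)
  moreover have "(z - w) * (z + w) \<le> (z - w) * (2 * z)"
    using wz by (intro mult_left_mono) auto
  ultimately have "1 \<le> 2 * (z - w) * z"
    by (simp only: mult_ac)
  also have "z \<le> z\<^sup>2"
    using mult_left_mono[of 1 z z] wz by (simp add: power2_eq_square z_def)
  then have "2 * (z - w) * z \<le> 2 * (z - w) * z\<^sup>2"
    using wz by (intro mult_left_mono) auto
  finally have "1 \<le> (2 * z - 2 * w) * z\<^sup>2"
    by (simp add: algebra_simps)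
  moreover have "z\<^sup>2 > 0" using wz by simp
  ultimately have "1 / (real v + 1) \<le> 2 * z - 2 * w"
    unfolding wz(5)[symmetric] by (simp only: pos_divide_le_eq)
  then have "2 ^ r * (1 / (real v + 1)) \<le> 2 ^ r * (2 * z - 2 * w)"
    by (intro mult_left_mono) auto
  moreover have "\<bar>t_term r \<sigma> (n + v)\<bar> \<le> 2 ^ r / (real v + 1) ^ 1"
    using assms by (intro abs_t_term_le) auto
  moreover have "h_sum (n + Suc v) r \<sigma> = h_sum (n + v) r \<sigma> + t_term r \<sigma> (n + v)"
    by (simp add: h_sum_eq_sum_t_term)
  moreover have "sqrt (real (Suc v)) = z" by (simp add: z_def add.commute)
  ultimately show ?case
    using Suc unfolding w_def[symmetric] by (simp add: algebra_simps)
qed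

text \<open>\<open>h_sum\<close> itself may diverge when r = 1, but a block of fixed length is a sum
  of finitely many null sequences.\<close>

lemma tendsto_h_sum_shift:
  assumes "\<sigma> \<in> {1, -1}" "r \<ge> 1"
  shows "(\<lambda>n. h_sum (n + v) r \<sigma> - h_sum n r \<sigma>) \<longlonglongrightarrow> 0"
proof (induction v)
  case 0
  then show ?case by simp
next
  case (Suc v)
  have "(\<lambda>n. t_term r \<sigma> (n + v)) \<longlonglongrightarrow> 0"
    using LIMSEQ_ignore_initial_segment[OF tendsto_int_t_term(1)[OF assms], of v]
    by (simp only: int_t_term_of_nat)
  from tendsto_add[OF Suc this] show ?case
    by (simp add: h_sum_eq_sum_t_term algebra_simps)
qed

lemma summable_sqrt_weight: "summable (\<lambda>v. C * sqrt (real v + 1) / (real v + 1) ^ 2)"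
proof -
  have "summable (\<lambda>n. real n powr (-3/2))"
    by (simp add: summable_real_powr_iff)
  then have "summable (\<lambda>n. real (Suc n) powr (-3/2))"
    by (subst summable_Suc_iff)
  moreover have "real (Suc v) powr (-3/2) = sqrt (real v + 1) / (real v + 1) ^ 2" for v
  proof -
    have "real (Suc v) powr (-3/2) = real (Suc v) powr (1/2) / real (Suc v) powr 2"
      by (subst powr_diff[symmetric]) simp
    then show ?thesis by (simp add: powr_half_sqrt add.commute)
  qed
  ultimately have "summable (\<lambda>v. sqrt (real v + 1) / (real v + 1) ^ 2)" by simp
  from summable_mult[OF this, of C] show ?thesis by simp
qed

text \<open>The majorant is a multiple of (v + 1)^(-3/2): an inverse square from
  \<open>t_term q\<close>, as q \<ge> 2, times the square root in \<open>bound\<close>.\<close>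

lemma tannery_t_term:
  assumes "\<sigma> \<in> {1, -1}" "q \<ge> 2"
    and lim: "\<And>v. (\<lambda>D. e v D) \<longlonglongrightarrow> l v"
    and bound: "\<And>v D. \<bar>e v D\<bar> \<le> C * sqrt (real v + 1)"
  shows "(\<lambda>D. \<Sum>v. t_term q \<sigma> v * e v D) \<longlonglongrightarrow> (\<Sum>v. t_term q \<sigma> v * l v)"
    and "summable (\<lambda>v. t_term q \<sigma> v * e v D)" "summable (\<lambda>v. t_term q \<sigma> v * l v)"
proof -
  define M where "M v = (2 ^ q * C) * sqrt (real v + 1) / (real v + 1) ^ 2" for v
  have le: "norm (t_term q \<sigma> v * e v D) \<le> M v" for v D
  proof -
    have "\<bar>t_term q \<sigma> v\<bar> * \<bar>e v D\<bar> \<le> (2 ^ q / (real v + 1) ^ 2) * (C * sqrt (real v + 1))"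
      using assms by (intro mult_mono abs_t_term_le bound) auto
    then show ?thesis by (simp add: M_def abs_mult)
  qed
  have M: "summable M" unfolding M_def by (rule summable_sqrt_weight)
  have T: "eventually (\<lambda>n. summable (\<lambda>k. norm (t_term q \<sigma> k * e k n))) sequentially \<and>
           summable (\<lambda>k. norm (t_term q \<sigma> k * l k)) \<and>
           ((\<lambda>n. \<Sum>k. t_term q \<sigma> k * e k n) \<longlongrightarrow> (\<Sum>k. t_term q \<sigma> k * l k)) sequentially"
    by (rule tannerys_theorem[where M = M])
       (use le in \<open>auto intro!: tendsto_intros lim M always_eventually\<close>)
  then show "(\<lambda>D. \<Sum>v. t_term q \<sigma> v * e v D) \<longlonglongrightarrow> (\<Sum>v. t_term q \<sigma> v * l v)"
    "summable (\<lambda>v. t_term q \<sigma> v * l v)"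
    by (auto intro: summable_norm_cancel)
  show "summable (\<lambda>v. t_term q \<sigma> v * e v D)"
    using M by (rule summable_comparison_test') (use le in auto)
qed

text \<open>The factor with exponent q carries the convergence; the other one is merely bounded, by
  2^p.\<close>

lemma summable_t_term_prods:
  assumes "\<sigma>1 \<in> {1, -1}" "\<sigma>2 \<in> {1, -1}" "q \<ge> 2"
  shows "summable (\<lambda>m. t_term p \<sigma>1 m * t_term q \<sigma>2 (m + d))"
    and "summable (\<lambda>m. t_term p \<sigma>1 (m + d) * t_term q \<sigma>2 m)"
proof -
  have "summable (t_term q 1)"
    using t_term_sums[of 1 q] assms by (auto simp: sums_iff)
  then have sum: "summable (\<lambda>m. 2 ^ p * t_term q 1 m)"
    by (rule summable_mult)
  have le: "\<bar>t_term p \<sigma>1 n\<bar> \<le> 2 ^ p" for n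
    using abs_t_term_le[of \<sigma>1 0 p 0 n] assms by simp
  have le': "\<bar>t_term q \<sigma>2 (m + k)\<bar> \<le> t_term q 1 m" for m k
    using assms by (auto simp: t_term_def abs_mult power_abs intro!: divide_left_mono power_mono)
  have bd: "norm (t_term p \<sigma>1 n * t_term q \<sigma>2 (m + k)) \<le> 2 ^ p * t_term q 1 m" for n m k
    unfolding real_norm_def abs_mult by (intro mult_mono le le') auto
  show "summable (\<lambda>m. t_term p \<sigma>1 m * t_term q \<sigma>2 (m + d))"
    using sum by (rule summable_comparison_test') (rule bd)
  show "summable (\<lambda>m. t_term p \<sigma>1 (m + d) * t_term q \<sigma>2 m)"
    using sum by (rule summable_comparison_test') (use bd[where k = 0] in simp)
qed

subsection \<open>Bilateral sums at a fixed difference\<close>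

text \<open>With x = i + 1/2 and y = x + d, the ranges i \<ge> 0, -d \<le> i < 0 and i < -d are the
  patterns 0 < x < y, x < 0 < y and x < y < 0. Each reflected variable contributes its sign and its
  power of -1.\<close>

lemma LIMSEQ_difference_sum_quadrants:
  assumes "\<sigma>1 \<in> {1, -1}" "\<sigma>2 \<in> {1, -1}" "q \<ge> 2"
  shows "(\<lambda>N. \<Sum>i\<in>{- int N..<int N}. int_t_term p \<sigma>1 i * int_t_term q \<sigma>2 (i + int d)) \<longlonglongrightarrow>
           (\<Sum>m. t_term p \<sigma>1 m * t_term q \<sigma>2 (m + d))
           + \<sigma>1 * (-1) ^ p * (\<Sum>n<d. t_term p \<sigma>1 n * t_term q \<sigma>2 (d - Suc n))
           + \<sigma>1 * \<sigma>2 * (-1) ^ (p + q) * (\<Sum>m. t_term p \<sigma>1 (m + d) * t_term q \<sigma>2 m)"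
proof -
  define F where "F i = int_t_term p \<sigma>1 i * int_t_term q \<sigma>2 (i + int d)" for i
  have pos: "F (int n) = t_term p \<sigma>1 n * t_term q \<sigma>2 (n + d)" for n
    unfolding F_def of_nat_add[symmetric] int_t_term_of_nat ..
  have mid: "F (- int n - 1) = \<sigma>1 * (-1) ^ p * (t_term p \<sigma>1 n * t_term q \<sigma>2 (d - Suc n))" if "n < d"
      for n
  proof -
    have "- int n - 1 + int d = int (d - Suc n)" using that by simp
    then show ?thesis by (simp add: F_def int_t_term_neg[OF assms(1)] del: of_nat_diff)
  qed
  have neg: "F (- int (m + d) - 1) = \<sigma>1 * \<sigma>2 * (-1) ^ (p + q)
      * (t_term p \<sigma>1 (m + d) * t_term q \<sigma>2 m)" for m
  proof -
    have "- int (m + d) - 1 + int d = - int m - 1" by simp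
    then show ?thesis
      unfolding F_def by (simp only: int_t_term_neg[OF assms(1)] int_t_term_neg[OF assms(2)])
        (simp add: power_add)
  qed
  have "(\<lambda>n. F (int n)) sums (\<Sum>m. t_term p \<sigma>1 m * t_term q \<sigma>2 (m + d))"
    unfolding pos using assms by (intro summable_sums summable_t_term_prods)
  moreover have "(\<lambda>n. F (- int n - 1)) sums (\<sigma>1 * \<sigma>2 * (-1) ^ (p + q)
      * (\<Sum>m. t_term p \<sigma>1 (m + d) * t_term q \<sigma>2 m)
        + (\<Sum>n<d. F (- int n - 1)))"
    \<comment> \<open>The first d terms of the negative half are the mixed pairs; after them both
      variables are negative.\<close>
    unfolding sums_iff_shift[of _ d, symmetric] neg
    using assms by (intro sums_mult summable_sums summable_t_term_prods)
  moreover have "(\<Sum>n<d. F (- int n - 1)) = \<sigma>1 * (-1) ^ p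
      * (\<Sum>n<d. t_term p \<sigma>1 n * t_term q \<sigma>2 (d - Suc n))"
    by (simp add: mid sum_distrib_left)
  ultimately show ?thesis
    unfolding F_def[symmetric] sum_symmetric_int sums_def
    by (auto dest: tendsto_add simp: algebra_simps)
qed

text \<open>The product of the two signs is a power of \<open>\<sigma>1 * \<sigma>2\<close> with
  exponent i, or i + d, times a factor depending on d only. Hence each partial fraction involves x
  alone or y alone, and its bilateral sum is known.\<close>

lemma LIMSEQ_difference_sum_partial_fractions:
  assumes "\<sigma>1 \<in> {1, -1}" "\<sigma>2 \<in> {1, -1}" "p + q \<ge> 1" "d \<ge> 1"
  shows "(\<lambda>N. \<Sum>i\<in>{- int N..<int N}. int_t_term p \<sigma>1 i * int_t_term q \<sigma>2 (i + int d)) \<longlonglongrightarrow>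
           (\<Sum>k<p. (-1) ^ k * real ((q + k - 1) choose k) * bilateral_t (p - k) (\<sigma>1 * \<sigma>2)
              * (\<sigma>2 ^ d / real d ^ (q + k)))
           + (-1) ^ p * (\<Sum>k<q. real ((p + k - 1) choose k) * bilateral_t (q - k) (\<sigma>1 * \<sigma>2)
              * (\<sigma>1 ^ d / real d ^ (p + k)))"
proof -
  define \<tau> where "\<tau> = \<sigma>1 * \<sigma>2"
  have \<tau>: "\<tau> \<in> {1, -1}" using assms by (auto simp: \<tau>_def)
  define c1 where "c1 k = (-1) ^ k * real ((q + k - 1) choose k) * (\<sigma>2 ^ d / real d ^ (q + k))" for k
  define c2 where "c2 k = (-1) ^ p * real ((p + k - 1) choose k) * (\<sigma>1 ^ d / real d ^ (p + k))" for k
  have eq: "int_t_term p \<sigma>1 i * int_t_term q \<sigma>2 (i + int d)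
     = (\<Sum>k<p. c1 k * int_t_term (p - k) \<tau> i) + (\<Sum>k<q. c2 k * int_t_term (q - k) \<tau> (i + int d))" for i
  proof -
    define x where "x = (of_int i + 1/2 :: real)"
    define y where "y = (of_int (i + int d) + 1/2 :: real)"
    have nz: "(of_int j + 1/2 :: real) \<noteq> 0" for j
    proof
      assume "(of_int j + 1/2 :: real) = 0"
      then have "(of_int (2 * j + 1) :: real) = 0" by simp
      then have "2 * j + 1 = 0" by (simp only: of_int_eq_0_iff)
      then show False by presburger
    qed
    have xy: "x \<noteq> 0" "y \<noteq> 0" "x \<noteq> y" "y - x = real d" "x - y = - real d"
      using nz[of i] nz[of "i + int d"] assms(4) by (simp_all add: x_def y_def)
    have shift: "\<sigma> powi (i + int d) = \<sigma> powi i * \<sigma> ^ d" if "\<sigma> \<in> {1, -1}" for \<sigma> :: real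
      using that by (subst power_int_add) (auto simp: power_int_of_nat)
    have s1: "\<sigma>1 powi i * \<sigma>2 powi (i + int d) = \<tau> powi i * \<sigma>2 ^ d"
      by (simp add: shift[OF assms(2)] \<tau>_def power_int_mult_distrib)
    have "\<sigma>1 ^ d * \<sigma>1 ^ d = 1" using assms(1) by (auto simp flip: power_mult_distrib)
    then have s2: "\<sigma>1 powi i * \<sigma>2 powi (i + int d) = \<tau> powi (i + int d) * \<sigma>1 ^ d"
      by (simp add: shift[OF assms(2)] shift[OF \<tau>])
          (simp add: \<tau>_def power_int_mult_distrib power_mult_distrib)
    have "int_t_term p \<sigma>1 i * int_t_term q \<sigma>2 (i + int d)
        = (\<sigma>1 powi i * \<sigma>2 powi (i + int d)) * (1 / (x ^ p * y ^ q))"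
      by (simp add: int_t_term_def x_def y_def)
    also have "\<dots> = (\<tau> powi i * \<sigma>2 ^ d) * pfrac p q x (real d)
        + (\<tau> powi (i + int d) * \<sigma>1 ^ d) * pfrac q p y (- real d)"
      unfolding partial_fractions[OF xy(1-3) assms(3)] xy(4,5) distrib_left using s1 s2 by simp
    also have "(\<tau> powi i * \<sigma>2 ^ d) * pfrac p q x (real d) = (\<Sum>k<p. c1 k * int_t_term (p - k) \<tau> i)"
      unfolding pfrac_def sum_distrib_left
      by (intro sum.cong refl) (simp add: c1_def int_t_term_def x_def)
    also have "(\<tau> powi (i + int d) * \<sigma>1 ^ d) * pfrac q p y (- real d)
        = (\<Sum>k<q. c2 k * int_t_term (q - k) \<tau> (i + int d))"
      unfolding pfrac_def sum_distrib_left
    proof (intro sum.cong refl)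
      fix k
      \<comment> \<open>The (-1)^k of \<open>pfrac\<close> cancels against that of (-d)^(p + k), and
        only (-1)^p remains.\<close>
      have "(- real d) ^ (p + k) = (-1) ^ p * (-1) ^ k * real d ^ (p + k)"
        by (subst power_minus) (simp add: power_add)
      moreover have "(-1) ^ k / ((-1) ^ p * (-1) ^ k * z) = (-1) ^ p / z" for z :: real
        by (cases "even k"; cases "even p") auto
      ultimately have "(-1) ^ k / (- real d) ^ (p + k) = (-1) ^ p / real d ^ (p + k)"
        by simp
      then show "(\<tau> powi (i + int d) * \<sigma>1 ^ d)
          * ((-1) ^ k * of_nat ((p + k - 1) choose k) / ((- real d) ^ (p + k) * y ^ (q - k)))
         = c2 k * int_t_term (q - k) \<tau> (i + int d)"
        unfolding times_divide_times_eq[symmetric] c2_def int_t_term_def y_def[symmetric]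
        by simp
    qed
    finally show ?thesis .
  qed
  have swap: "(\<Sum>i\<in>{- int N..<int N}. int_t_term p \<sigma>1 i * int_t_term q \<sigma>2 (i + int d))
      = (\<Sum>k<p. c1 k * (\<Sum>i\<in>{- int N..<int N}. int_t_term (p - k) \<tau> i))
        + (\<Sum>k<q. c2 k * (\<Sum>i\<in>{- int N..<int N}. int_t_term (q - k) \<tau> (i + int d)))" for N
    unfolding eq sum.distrib sum_distrib_left by (intro arg_cong2[where f = "(+)"] sum.swap)
  have "(\<lambda>N. (\<Sum>k<p. c1 k * (\<Sum>i\<in>{- int N..<int N}. int_t_term (p - k) \<tau> i))
        + (\<Sum>k<q. c2 k * (\<Sum>i\<in>{- int N..<int N}. int_t_term (q - k) \<tau> (i + int d))))
       \<longlonglongrightarrow> (\<Sum>k<p. c1 k * bilateral_t (p - k) \<tau>) + (\<Sum>k<q. c2 k * bilateral_t (q - k) \<tau>)"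
    by (intro tendsto_intros LIMSEQ_symmetric_sum_shift LIMSEQ_bilateral_t \<tau> tendsto_int_t_term) auto
  then show ?thesis
    unfolding swap \<tau>_def[symmetric] c1_def c2_def
    by (simp add: sum_distrib_left mult_ac)
qed

subsection \<open>Summation over the difference\<close>

text \<open>Collecting by the index v = m + d of y, the indices of x form the block from v - D to v
  - 1; truncated subtraction handles v < D.\<close>

lemma suminf_diagonals:
  assumes "\<sigma>1 \<in> {1, -1}" "\<sigma>2 \<in> {1, -1}" "q \<ge> 2"
  shows "(\<Sum>d=1..D. \<Sum>m. t_term p \<sigma>1 m * t_term q \<sigma>2 (m + d))
           = (\<Sum>v. t_term q \<sigma>2 v * (h_sum v p \<sigma>1 - h_sum (v - D) p \<sigma>1))"
proof -
  \<comment> \<open>Each diagonal is padded with zeros below index d, so that all D series share the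
    variable v.\<close>
  define g where "g d v = (if d \<le> v then t_term p \<sigma>1 (v - d) * t_term q \<sigma>2 v else 0)" for d v
  have "g d sums (\<Sum>m. t_term p \<sigma>1 m * t_term q \<sigma>2 (m + d))" for d
  proof -
    have "(\<lambda>m. g d (m + d)) sums (\<Sum>m. t_term p \<sigma>1 m * t_term q \<sigma>2 (m + d))"
      using summable_t_term_prods(1)[OF assms] by (simp add: g_def summable_sums)
    moreover have "(\<Sum>m<d. g d m) = 0" by (simp add: g_def)
    ultimately show ?thesis by (simp add: sums_iff_shift[of "g d" d])
  qed
  then have "(\<lambda>v. \<Sum>d=1..D. g d v) sums (\<Sum>d=1..D. \<Sum>m. t_term p \<sigma>1 m * t_term q \<sigma>2 (m + d))"
    by (intro sums_sum)
  moreover have "(\<Sum>d=1..D. g d v) = t_term q \<sigma>2 v * (h_sum v p \<sigma>1 - h_sum (v - D) p \<sigma>1)" for v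
  proof (induction D)
    case 0
    then show ?case by simp
  next
    case (Suc D)
    show ?case
    proof (cases "Suc D \<le> v")
      case True
      then have "v - D = Suc (v - Suc D)" by simp
      with Suc True show ?thesis by (simp add: g_def h_sum_eq_sum_t_term algebra_simps)
    next
      case False
      with Suc show ?thesis by (simp add: g_def)
    qed
  qed
  ultimately show ?thesis by (simp add: sums_iff)
qed

text \<open>The variable v is now the index of the reflected y, and d runs through the D indices
  after v. Starting at \<open>Suc v\<close> is what later brings in the diagonal.\<close>

lemma suminf_codiagonals:
  assumes "\<sigma>1 \<in> {1, -1}" "\<sigma>2 \<in> {1, -1}" "q \<ge> 2"
  shows "(\<Sum>d=1..D. \<Sum>m. t_term p \<sigma>1 (m + d) * t_term q \<sigma>2 m)
           = (\<Sum>v. t_term q \<sigma>2 v * (h_sum (Suc v + D) p \<sigma>1 - h_sum (Suc v) p \<sigma>1))"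
proof -
  have "(\<lambda>m. \<Sum>d=1..D. t_term p \<sigma>1 (m + d) * t_term q \<sigma>2 m) sums
      (\<Sum>d=1..D. \<Sum>m. t_term p \<sigma>1 (m + d) * t_term q \<sigma>2 m)"
    using summable_t_term_prods(2)[OF assms] by (intro sums_sum summable_sums)
  moreover have "(\<Sum>d=1..D. t_term p \<sigma>1 (m + d) * t_term q \<sigma>2 m)
      = t_term q \<sigma>2 m * (h_sum (Suc m + D) p \<sigma>1 - h_sum (Suc m) p \<sigma>1)" for m
    by (induction D) (simp_all add: h_sum_eq_sum_t_term algebra_simps)
  ultimately show ?thesis by (simp add: sums_iff)
qed

text \<open>The pairs are those with n + v < D. The finite sum over v is written as a series, with
  zero terms where \<open>D - v = 0\<close>, to fit Tannery's theorem.\<close>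

lemma sum_antidiagonals:
  "(\<Sum>d=1..D. \<Sum>n<d. t_term p \<sigma>1 n * t_term q \<sigma>2 (d - Suc n))
     = (\<Sum>v. t_term q \<sigma>2 v * h_sum (D - v) p \<sigma>1)"
proof -
  have "(\<Sum>d=1..D. \<Sum>n<d. t_term p \<sigma>1 n * t_term q \<sigma>2 (d - Suc n))
      = (\<Sum>v<D. t_term q \<sigma>2 v * h_sum (D - v) p \<sigma>1)"
  proof -
    have "(\<Sum>d=1..D. \<Sum>n<d. t_term p \<sigma>1 n * t_term q \<sigma>2 (d - Suc n))
       = (\<Sum>(d, n)\<in>(SIGMA d:{1..D}. {..<d}). t_term p \<sigma>1 n * t_term q \<sigma>2 (d - Suc n))"
      by (rule sum.Sigma) auto
    also have "\<dots> = (\<Sum>(v, n)\<in>(SIGMA v:{..<D}. {..<D - v}). t_term q \<sigma>2 v * t_term p \<sigma>1 n)"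
      by (rule sum.reindex_bij_witness[of _ "\<lambda>(v, n). (Suc (v + n), n)" "\<lambda>(d, n). (d - Suc n, n)"]) auto
    also have "\<dots> = (\<Sum>v<D. \<Sum>n<D - v. t_term q \<sigma>2 v * t_term p \<sigma>1 n)"
      by (rule sum.Sigma[symmetric]) auto
    finally show ?thesis by (simp add: h_sum_eq_sum_t_term sum_distrib_left)
  qed
  also have "\<dots> = (\<Sum>v. t_term q \<sigma>2 v * h_sum (D - v) p \<sigma>1)"
    by (rule suminf_finite[symmetric]) (auto simp: h_sum_eq_sum_t_term)
  finally show ?thesis .
qed

lemma euler_T_eq: "euler_T p q \<sigma>1 \<sigma>2 = (\<Sum>v. t_term q \<sigma>2 v * h_sum v p \<sigma>1)"
  by (simp add: euler_T_def t_term_def algebra_simps)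

section \<open>Limits of the three families of pairs and the bilateral identity\<close>

context
  fixes \<sigma>1 \<sigma>2 :: real and p q :: nat
  assumes signs: "\<sigma>1 \<in> {1, -1}" "\<sigma>2 \<in> {1, -1}" and p: "p \<ge> 1" and q: "q \<ge> 2"
begin

lemma abs_h_sum_diff_le':
  assumes "v \<le> Suc w"
  shows "\<bar>h_sum (n + v) p \<sigma>1 - h_sum n p \<sigma>1\<bar> \<le> 2 ^ (p + 1) * sqrt (real w + 1)"
proof -
  have "\<bar>h_sum (n + v) p \<sigma>1 - h_sum n p \<sigma>1\<bar> \<le> 2 ^ p * (2 * sqrt (real v))"
    by (rule abs_h_sum_diff_le[OF signs(1) p])
  also have "\<dots> \<le> 2 ^ p * (2 * sqrt (real w + 1))"
    using assms by (intro mult_left_mono) auto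
  finally show ?thesis by simp
qed

lemma LIMSEQ_diagonals:
  "(\<lambda>D. \<Sum>d=1..D. \<Sum>m. t_term p \<sigma>1 m * t_term q \<sigma>2 (m + d)) \<longlonglongrightarrow> euler_T p q \<sigma>1 \<sigma>2"
  unfolding suminf_diagonals[OF signs q] euler_T_eq
proof (rule tannery_t_term(1)[OF signs(2) q])
  fix v D
  have "eventually (\<lambda>D. h_sum v p \<sigma>1 - h_sum (v - D) p \<sigma>1 = h_sum v p \<sigma>1) sequentially"
    using eventually_ge_at_top[of v] by eventually_elim (simp add: h_sum_eq_sum_t_term)
  then show "(\<lambda>D. h_sum v p \<sigma>1 - h_sum (v - D) p \<sigma>1) \<longlonglongrightarrow> h_sum v p \<sigma>1"
    by (rule tendsto_eventually)
  show "\<bar>h_sum v p \<sigma>1 - h_sum (v - D) p \<sigma>1\<bar> \<le> 2 ^ (p + 1) * sqrt (real v + 1)"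
    using abs_h_sum_diff_le'[of "min v D" v "v - D"] by (cases "v \<le> D") auto
qed

text \<open>For fixed v, replacing \<open>D - v\<close> by \<open>D\<close> in \<open>h_sum\<close>
  costs a null sequence, so the sum behaves like \<open>h_sum D p \<sigma>1\<close> times the total
  of \<open>t_term q \<sigma>2\<close>. Subtracting this product keeps the divergent case p = 1,
  \<open>\<sigma>1 = 1\<close> within reach.\<close>

lemma LIMSEQ_antidiagonals:
  "(\<lambda>D. (\<Sum>d=1..D. \<Sum>n<d. t_term p \<sigma>1 n * t_term q \<sigma>2 (d - Suc n))
         - \<sigma>2 * alt_t q \<sigma>2 * h_sum D p \<sigma>1) \<longlonglongrightarrow> 0"
proof -
  have lim: "(\<lambda>D. h_sum (D - v) p \<sigma>1 - h_sum D p \<sigma>1) \<longlonglongrightarrow> 0" for v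
    by (rule LIMSEQ_offset[of _ v])
       (use tendsto_minus[OF tendsto_h_sum_shift[OF signs(1) p, of v]] in simp)
  have bound: "\<bar>h_sum (D - v) p \<sigma>1 - h_sum D p \<sigma>1\<bar> \<le> 2 ^ (p + 1) * sqrt (real v + 1)" for v D
    using abs_h_sum_diff_le'[of "min v D" v "D - v"] by (cases "v \<le> D") (auto simp: abs_minus_commute)
  have eq: "(\<Sum>v. t_term q \<sigma>2 v * h_sum (D - v) p \<sigma>1)
      = (\<Sum>v. t_term q \<sigma>2 v * (h_sum (D - v) p \<sigma>1 - h_sum D p \<sigma>1)) + \<sigma>2 * alt_t q \<sigma>2 * h_sum D p \<sigma>1"
          for D
  proof -
    have "(\<lambda>v. t_term q \<sigma>2 v * (h_sum (D - v) p \<sigma>1 - h_sum D p \<sigma>1) + t_term q \<sigma>2 v * h_sum D p \<sigma>1)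
        sums ((\<Sum>v. t_term q \<sigma>2 v * (h_sum (D - v) p \<sigma>1 - h_sum D p \<sigma>1))
            + \<sigma>2 * alt_t q \<sigma>2 * h_sum D p \<sigma>1)"
      by (intro sums_add sums_mult2 t_term_sums summable_sums signs q
            tannery_t_term(2)[OF signs(2) q lim bound])
    then show ?thesis by (simp add: sums_iff algebra_simps)
  qed
  show ?thesis
    unfolding sum_antidiagonals eq
    using tannery_t_term(1)[OF signs(2) q lim bound] by simp
qed

text \<open>The D terms after index v amount to \<open>h_sum D p \<sigma>1\<close>, up to a null
  sequence, minus the first v + 1 terms. Of these, the indices below v give \<open>euler_T\<close>
  and the index v gives the diagonal.\<close>

lemma LIMSEQ_codiagonals:
  "(\<lambda>D. (\<Sum>d=1..D. \<Sum>m. t_term p \<sigma>1 (m + d) * t_term q \<sigma>2 m)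
         - \<sigma>2 * alt_t q \<sigma>2 * h_sum D p \<sigma>1)
     \<longlonglongrightarrow> - (euler_T p q \<sigma>1 \<sigma>2 + \<sigma>1 * \<sigma>2 * alt_t (p + q) (\<sigma>1 * \<sigma>2))"
proof -
  define e where "e v D = h_sum (Suc v + D) p \<sigma>1 - h_sum (Suc v) p \<sigma>1 - h_sum D p \<sigma>1" for v D
  have lim: "(\<lambda>D. e v D) \<longlonglongrightarrow> - h_sum (Suc v) p \<sigma>1" for v
    using tendsto_diff[OF tendsto_h_sum_shift[OF signs(1) p, of "Suc v"]
        tendsto_const[of "h_sum (Suc v) p \<sigma>1"]]
    by (simp add: e_def algebra_simps)
  \<comment> \<open>\<open>e v D\<close> is the difference of two blocks of length v + 1, one
    starting at D and one at 0.\<close>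
  have bound: "\<bar>e v D\<bar> \<le> 2 ^ (p + 2) * sqrt (real v + 1)" for v D
    using abs_h_sum_diff_le'[of "Suc v" v D] abs_h_sum_diff_le'[of "Suc v" v 0]
    by (simp add: e_def add.commute h_sum_eq_sum_t_term)
  have eq: "(\<Sum>v. t_term q \<sigma>2 v * (h_sum (Suc v + D) p \<sigma>1 - h_sum (Suc v) p \<sigma>1))
      = (\<Sum>v. t_term q \<sigma>2 v * e v D) + \<sigma>2 * alt_t q \<sigma>2 * h_sum D p \<sigma>1" for D
  proof -
    have "(\<lambda>v. t_term q \<sigma>2 v * e v D + t_term q \<sigma>2 v * h_sum D p \<sigma>1)
        sums ((\<Sum>v. t_term q \<sigma>2 v * e v D) + \<sigma>2 * alt_t q \<sigma>2 * h_sum D p \<sigma>1)"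
      by (intro sums_add sums_mult2 t_term_sums summable_sums signs q
            tannery_t_term(2)[OF signs(2) q lim bound])
    then show ?thesis by (simp add: sums_iff e_def algebra_simps)
  qed
  have "(\<Sum>v. t_term q \<sigma>2 v * - h_sum (Suc v) p \<sigma>1)
      = - (euler_T p q \<sigma>1 \<sigma>2 + \<sigma>1 * \<sigma>2 * alt_t (p + q) (\<sigma>1 * \<sigma>2))"
  proof -
    have prod: "t_term q \<sigma>2 v * t_term p \<sigma>1 v = t_term (p + q) (\<sigma>1 * \<sigma>2) v" for v
      by (simp add: t_term_def power_add power_mult_distrib mult.commute)
    have s: "summable (\<lambda>v. t_term q \<sigma>2 v * - h_sum (Suc v) p \<sigma>1)"
      by (rule tannery_t_term(3)[OF signs(2) q lim bound])
    have "t_term (p + q) (\<sigma>1 * \<sigma>2) sums (\<sigma>1 * \<sigma>2 * alt_t (p + q) (\<sigma>1 * \<sigma>2))"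
      using signs p q by (intro t_term_sums) auto
    from sums_add[OF summable_sums[OF s] this]
    have "(\<lambda>v. - (t_term q \<sigma>2 v * h_sum v p \<sigma>1)) sums
      ((\<Sum>v. t_term q \<sigma>2 v * - h_sum (Suc v) p \<sigma>1) + \<sigma>1 * \<sigma>2 * alt_t (p + q) (\<sigma>1 * \<sigma>2))"
      by (simp add: prod[symmetric] h_sum_eq_sum_t_term algebra_simps)
    from sums_minus[OF this] show ?thesis
      by (simp add: euler_T_eq sums_iff)
  qed
  then show ?thesis
    unfolding suminf_codiagonals[OF signs q] eq
    using tannery_t_term(1)[OF signs(2) q lim bound] by simp
qed

text \<open>For every d the quadrant and the partial fraction evaluations are limits of the same
  symmetric sums; equate them, sum over d \<le> D and let D grow.\<close>

lemma euler_T_bilateral: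
  "(1 - \<sigma>1 * \<sigma>2 * (-1) ^ (p + q)) * euler_T p q \<sigma>1 \<sigma>2
      - \<sigma>1 * \<sigma>2 * (-1) ^ (p + q) * (\<sigma>1 * \<sigma>2 * alt_t (p + q) (\<sigma>1 * \<sigma>2))
      + (-1) ^ p * bilateral_t q \<sigma>2 * alt_t p \<sigma>1
   = (\<Sum>k<p. (-1) ^ k * real ((q + k - 1) choose k) * bilateral_t (p - k) (\<sigma>1 * \<sigma>2) * alt_zeta (q
       + k) \<sigma>2)
     + (-1) ^ p * (\<Sum>k<q. real ((p + k - 1) choose k) * bilateral_t (q - k) (\<sigma>1 * \<sigma>2) * alt_zeta (p
         + k) \<sigma>1)"
proof -
  define \<tau> where "\<tau> = \<sigma>1 * \<sigma>2"
  \<comment> \<open>\<open>H p D\<close> is the divergent part at \<open>p = 1\<close>, \<open>\<sigma>1 = 1\<close>; it occurs with the same factor on both sides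
      and accounts for the regularised values of \<open>alt_t 1 1\<close> and \<open>alt_zeta 1 1\<close>.\<close>
  define H :: "nat \<Rightarrow> nat \<Rightarrow> real" where "H s D = (if s = 1 \<and> \<sigma>1 = 1 then harm D else 0)" for s D
  define Z where "Z s \<sigma> D = (\<Sum>d=1..D. \<sigma> ^ d / real d ^ s)" for s and \<sigma> :: real and D
  define P where "P D = (\<Sum>d=1..D. \<Sum>m. t_term p \<sigma>1 m * t_term q \<sigma>2 (m + d))" for D
  define M where "M D = (\<Sum>d=1..D. \<Sum>n<d. t_term p \<sigma>1 n * t_term q \<sigma>2 (d - Suc n))" for D
  define N where "N D = (\<Sum>d=1..D. \<Sum>m. t_term p \<sigma>1 (m + d) * t_term q \<sigma>2 m)" for D
  define G where "G = \<sigma>2 * alt_t q \<sigma>2"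
  define c1 where "c1 k = (-1) ^ k * real ((q + k - 1) choose k) * bilateral_t (p - k) \<tau>" for k
  define c2 where "c2 k = real ((p + k - 1) choose k) * bilateral_t (q - k) \<tau>" for k
  define L where "L D = P D + \<sigma>1 * (-1) ^ p * M D + \<tau> * (-1) ^ (p + q) * N D" for D
  define R where "R D = (\<Sum>k<p. c1 k * Z (q + k) \<sigma>2 D) + (-1) ^ p * (\<Sum>k<q. c2 k * Z (p + k) \<sigma>1 D)" for D
  have "(\<Sum>m. t_term p \<sigma>1 m * t_term q \<sigma>2 (m + d))
           + \<sigma>1 * (-1) ^ p * (\<Sum>n<d. t_term p \<sigma>1 n * t_term q \<sigma>2 (d - Suc n))
           + \<tau> * (-1) ^ (p + q) * (\<Sum>m. t_term p \<sigma>1 (m + d) * t_term q \<sigma>2 m)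
      = (\<Sum>k<p. c1 k * (\<sigma>2 ^ d / real d ^ (q + k)))
          + (-1) ^ p * (\<Sum>k<q. c2 k * (\<sigma>1 ^ d / real d ^ (p + k)))"
    if "d \<ge> 1" for d
    unfolding \<tau>_def c1_def c2_def
    using LIMSEQ_difference_sum_quadrants[OF signs q, of p d]
      LIMSEQ_difference_sum_partial_fractions[OF signs _ that, of p q] q
    by (intro LIMSEQ_unique) auto
  then have "(\<Sum>d=1..D. (\<Sum>m. t_term p \<sigma>1 m * t_term q \<sigma>2 (m + d))
           + \<sigma>1 * (-1) ^ p * (\<Sum>n<d. t_term p \<sigma>1 n * t_term q \<sigma>2 (d - Suc n))
           + \<tau> * (-1) ^ (p + q) * (\<Sum>m. t_term p \<sigma>1 (m + d) * t_term q \<sigma>2 m))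
      = (\<Sum>d=1..D. (\<Sum>k<p. c1 k * (\<sigma>2 ^ d / real d ^ (q + k)))
          + (-1) ^ p * (\<Sum>k<q. c2 k * (\<sigma>1 ^ d / real d ^ (p + k))))" for D
    by (intro sum.cong) auto
  then have "L D = (\<Sum>d=1..D. \<Sum>k<p. c1 k * (\<sigma>2 ^ d / real d ^ (q + k)))
      + (-1) ^ p * (\<Sum>d=1..D. \<Sum>k<q. c2 k * (\<sigma>1 ^ d / real d ^ (p + k)))" for D
    by (simp only: L_def P_def M_def N_def sum.distrib sum_distrib_left[symmetric])
  then have LR: "L D = R D" for D
    unfolding R_def Z_def sum_distrib_left[of _ _ "{1..D}"]
    by (simp only: sum.swap[of _ "{..<p}"] sum.swap[of _ "{..<q}"])

  have A: "(\<lambda>D. \<sigma>1 * h_sum D p \<sigma>1 - H p D) \<longlonglongrightarrow> alt_t p \<sigma>1"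
    unfolding H_def using signs(1) p by (rule LIMSEQ_h_sum)
  \<comment> \<open>The multiples of \<open>G * h_sum D p \<sigma>1\<close> that belong to
    \<open>M D\<close> and \<open>N D\<close> add up, with their weights, to \<open>(-1) ^ p *
    bilateral_t q \<sigma>2 * (\<sigma>1 * h_sum D p \<sigma>1)\<close>, to which \<open>A\<close>
    applies.\<close>
  have B: "bilateral_t q \<sigma>2 = G * (1 + \<sigma>2 * (-1) ^ q)"
    by (simp add: bilateral_t_eq[OF signs(2)] G_def)
  have "(\<lambda>D. P D + \<sigma>1 * (-1) ^ p * (M D - G * h_sum D p \<sigma>1)
           + \<tau> * (-1) ^ (p + q) * (N D - G * h_sum D p \<sigma>1)
           + (-1) ^ p * bilateral_t q \<sigma>2 * (\<sigma>1 * h_sum D p \<sigma>1 - H p D))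
     \<longlonglongrightarrow> euler_T p q \<sigma>1 \<sigma>2 + \<sigma>1 * (-1) ^ p * 0
       + \<tau> * (-1) ^ (p + q) * (- (euler_T p q \<sigma>1 \<sigma>2 + \<tau> * alt_t (p + q) \<tau>))
       + (-1) ^ p * bilateral_t q \<sigma>2 * alt_t p \<sigma>1"
    unfolding P_def M_def N_def G_def \<tau>_def
    by (intro tendsto_intros A LIMSEQ_diagonals LIMSEQ_antidiagonals LIMSEQ_codiagonals)
  moreover have "P D + \<sigma>1 * (-1) ^ p * (M D - G * h_sum D p \<sigma>1)
           + \<tau> * (-1) ^ (p + q) * (N D - G * h_sum D p \<sigma>1)
           + (-1) ^ p * bilateral_t q \<sigma>2 * (\<sigma>1 * h_sum D p \<sigma>1 - H p D)
       = L D - (-1) ^ p * bilateral_t q \<sigma>2 * H p D" for D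
    by (simp add: L_def B \<tau>_def power_add algebra_simps)
  ultimately have limL: "(\<lambda>D. L D - (-1) ^ p * bilateral_t q \<sigma>2 * H p D)
      \<longlonglongrightarrow> euler_T p q \<sigma>1 \<sigma>2 + \<sigma>1 * (-1) ^ p * 0
       + \<tau> * (-1) ^ (p + q) * (- (euler_T p q \<sigma>1 \<sigma>2 + \<tau> * alt_t (p + q) \<tau>))
       + (-1) ^ p * bilateral_t q \<sigma>2 * alt_t p \<sigma>1"
    by simp

  have Z2: "(\<lambda>D. Z (q + k) \<sigma>2 D) \<longlonglongrightarrow> alt_zeta (q + k) \<sigma>2" for k
    using LIMSEQ_signed_harmonic[OF signs(2), of "q + k"] q by (simp add: Z_def)
  have Z1: "(\<lambda>D. Z (p + k) \<sigma>1 D - H (p + k) D) \<longlonglongrightarrow> alt_zeta (p + k) \<sigma>1" for k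
    using LIMSEQ_signed_harmonic[OF signs(1), of "p + k"] p unfolding Z_def H_def by simp
  have "(\<lambda>D. (\<Sum>k<p. c1 k * Z (q + k) \<sigma>2 D) + (-1) ^ p * (\<Sum>k<q. c2 k * (Z (p + k) \<sigma>1 D - H (p + k) D)))
     \<longlonglongrightarrow> (\<Sum>k<p. c1 k * alt_zeta (q + k) \<sigma>2) + (-1) ^ p * (\<Sum>k<q. c2 k * alt_zeta (p + k) \<sigma>1)"
    by (intro tendsto_intros Z1 Z2)
  moreover have "(\<Sum>k<p. c1 k * Z (q + k) \<sigma>2 D)
      + (-1) ^ p * (\<Sum>k<q. c2 k * (Z (p + k) \<sigma>1 D - H (p + k) D))
      = R D - (-1) ^ p * bilateral_t q \<sigma>2 * H p D" for D
  proof -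
    \<comment> \<open>\<open>H (p + k)\<close> is zero for k \<ge> 1. At k = 0 the coefficient is
      \<open>bilateral_t q \<tau>\<close>, and \<open>\<tau> = \<sigma>2\<close> wherever
      \<open>H p D\<close> is nonzero, since then \<open>\<sigma>1 = 1\<close>. So the divergent
      parts of both sides agree.\<close>
    have "(\<Sum>k<q. c2 k * H (p + k) D) = (\<Sum>k\<in>{0}. c2 k * H (p + k) D)"
      using p q by (intro sum.mono_neutral_right) (auto simp: H_def)
    also have "\<dots> = bilateral_t q \<sigma>2 * H p D"
      by (simp add: c2_def H_def \<tau>_def)
    finally show ?thesis
      by (simp add: R_def right_diff_distrib sum_subtractf)
  qed
  ultimately have "(\<lambda>D. L D - (-1) ^ p * bilateral_t q \<sigma>2 * H p D)
      \<longlonglongrightarrow> (\<Sum>k<p. c1 k * alt_zeta (q + k) \<sigma>2) + (-1) ^ p * (\<Sum>k<q. c2 k * alt_zeta (p + k) \<sigma>1)"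
    by (simp add: LR)
  from LIMSEQ_unique[OF limL this] show ?thesis
    unfolding c1_def c2_def \<tau>_def by (simp add: algebra_simps)
qed

end

section \<open>Translation into the stated form\<close>

lemma delta_eq: "delta \<sigma> (int a - int b) = 1 - \<sigma> * (-1) ^ (a + b)"
  by (cases "even b") (simp_all add: delta_def power_int_diff power_add power_int_of_nat)

theorem theorem3p2:
  fixes p q :: nat and \<sigma>1 \<sigma>2 :: real
  assumes "p \<ge> 1" and "q \<ge> 2"
    and "\<sigma>1 \<in> {1, -1}" and "\<sigma>2 \<in> {1, -1}"
  shows "(-1) ^ p * delta (\<sigma>1 * \<sigma>2) (int (p + q)) * euler_T p q \<sigma>1 \<sigma>2 =
      (-1) ^ q * alt_t (p + q) (\<sigma>1 * \<sigma>2)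
      - \<sigma>2 * delta \<sigma>2 (int q - 1) * alt_t p \<sigma>1 * alt_t q \<sigma>2
      + (\<Sum>k=1..p. delta (\<sigma>1 * \<sigma>2) (int p - int k) * real ((q + k - 2) choose (q - 1))
            * alt_t (p - k + 1) (\<sigma>1 * \<sigma>2) * alt_zeta (q + k - 1) \<sigma>2)
      + \<sigma>1 * \<sigma>2 * (\<Sum>k=1..q. delta (\<sigma>1 * \<sigma>2) (int q - int k) * real ((p + k - 2) choose (p - 1))
            * alt_t (q - k + 1) (\<sigma>1 * \<sigma>2) * alt_zeta (p + k - 1) \<sigma>1)"
proof -
  define \<tau> where "\<tau> = \<sigma>1 * \<sigma>2"
  have \<tau>: "\<tau> \<in> {1, -1}" using assms(3,4) by (auto simp: \<tau>_def)
  have choose_eq: "(n + Suc k - 2) choose (n - 1) = (n + k - 1) choose k" if "n \<ge> 1" for n k :: nat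
    using that binomial_symmetric[of k "n + k - 1"] by (simp add: algebra_simps)
  have sum1: "(\<Sum>k=1..p. delta \<tau> (int p - int k) * real ((q + k - 2) choose (q - 1))
            * alt_t (p - k + 1) \<tau> * alt_zeta (q + k - 1) \<sigma>2)
      = (-1) ^ p * (\<Sum>k<p. (-1) ^ k * real ((q + k - 1) choose k) * bilateral_t (p - k) \<tau>
          * alt_zeta (q + k) \<sigma>2)"
    unfolding sum_distrib_left
  proof (rule sum.reindex_bij_witness[of _ Suc "\<lambda>k. k - 1"])
    fix k assume "k \<in> {1..p}"
    then obtain m where m: "k = Suc m" "m < p" by (cases k) auto
    have "delta \<tau> (int (p - m) - 1) = delta \<tau> (int p - int k)" "p - k + 1 = p - m"
      using m by (simp_all add: algebra_simps)
    \<comment> \<open>Where delta does not vanish, \<tau> = (-1)^(p + m), so the prefactor is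
      1.\<close>
    moreover have "(-1) ^ p * (-1) ^ m * \<tau> * delta \<tau> (int p - int k) = delta \<tau> (int p - int k)"
      unfolding delta_eq m using \<tau> by (cases "even p"; cases "even m") auto
    ultimately show "(-1) ^ p * ((-1) ^ (k - 1) * real ((q + (k - 1) - 1) choose (k - 1))
        * bilateral_t (p - (k - 1)) \<tau> * alt_zeta (q + (k - 1)) \<sigma>2)
      = delta \<tau> (int p - int k) * real ((q + k - 2) choose (q - 1)) * alt_t (p - k + 1) \<tau>
          * alt_zeta (q + k - 1) \<sigma>2"
      using choose_eq[of q m] assms(2) unfolding bilateral_t_def m(1) diff_Suc_1
      by (auto simp: mult_ac)
  qed auto
  have sum2: "\<tau> * (\<Sum>k=1..q. delta \<tau> (int q - int k) * real ((p + k - 2) choose (p - 1))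
            * alt_t (q - k + 1) \<tau> * alt_zeta (p + k - 1) \<sigma>1)
      = (\<Sum>k<q. real ((p + k - 1) choose k) * bilateral_t (q - k) \<tau> * alt_zeta (p + k) \<sigma>1)"
    unfolding sum_distrib_left
  proof (rule sum.reindex_bij_witness[of _ Suc "\<lambda>k. k - 1"])
    fix k assume "k \<in> {1..q}"
    then obtain m where m: "k = Suc m" "m < q" by (cases k) auto
    then have "delta \<tau> (int (q - m) - 1) = delta \<tau> (int q - int k)" "q - k + 1 = q - m"
      by (simp_all add: algebra_simps)
    then show "real ((p + (k - 1) - 1) choose (k - 1)) * bilateral_t (q - (k - 1)) \<tau> * alt_zeta (p
        + (k - 1)) \<sigma>1
      = \<tau> * (delta \<tau> (int q - int k) * real ((p + k - 2) choose (p - 1)) * alt_t (q - k + 1) \<tau>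
          * alt_zeta (p + k - 1) \<sigma>1)"
      using choose_eq[of p m] assms(1) unfolding bilateral_t_def m(1) diff_Suc_1
      by (simp add: mult_ac)
  qed auto
  have d: "delta \<tau> (int (p + q)) = 1 - \<tau> * (-1) ^ (p + q)"
    using delta_eq[of \<tau> "p + q" 0] by simp
  have pp: "(-1) ^ p * ((-1) ^ p * x) = x" "\<tau> * (\<tau> * x) = x" for x :: real
    using \<tau> by (cases "even p", auto)+
  \<comment> \<open>Multiplying the bilateral identity by (-1)^p puts that sign before
    \<open>euler_T\<close> and, as \<tau>^2 = 1, leaves (-1)^q before
    \<open>alt_t (p + q) \<tau>\<close>.\<close>
  have "(-1) ^ p * delta \<tau> (int (p + q)) * euler_T p q \<sigma>1 \<sigma>2
     - (-1) ^ q * alt_t (p + q) \<tau> + bilateral_t q \<sigma>2 * alt_t p \<sigma>1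
    = (-1) ^ p * ((1 - \<tau> * (-1) ^ (p + q)) * euler_T p q \<sigma>1 \<sigma>2
      - \<tau> * (-1) ^ (p + q) * (\<tau> * alt_t (p + q) \<tau>)
      + (-1) ^ p * bilateral_t q \<sigma>2 * alt_t p \<sigma>1)"
    unfolding d by (simp add: power_add algebra_simps pp)
  also have "\<dots> = (-1) ^ p * (\<Sum>k<p. (-1) ^ k * real ((q + k - 1) choose k) * bilateral_t (p - k) \<tau>
      * alt_zeta (q + k) \<sigma>2)
     + (\<Sum>k<q. real ((p + k - 1) choose k) * bilateral_t (q - k) \<tau> * alt_zeta (p + k) \<sigma>1)"
    using euler_T_bilateral[OF assms(3,4,1,2)] by (simp only: \<tau>_def distrib_left pp)
  moreover have "bilateral_t q \<sigma>2 * alt_t p \<sigma>1 = \<sigma>2 * delta \<sigma>2 (int q - 1) * alt_t p \<sigma>1 * alt_t q \<sigma>2"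
    by (simp add: bilateral_t_def)
  ultimately show ?thesis
    unfolding \<tau>_def[symmetric] sum1 sum2 by linarith
qed

end
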